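(* Let $T$ be a binary tree. The number $NA(T)$ of non-ambiguous trees with underlying binary tree $T$ is $$NA(T)=\frac{\#\{\text{left edges of }T\}!\;\cdot\;\#\{\text{right edges of }T\}!}{\displaystyle\prod_{e\in V_L} n_e\;\prod_{e\in V_R} n_e},$$ where the first (resp. second) product is over the left (resp. right) edges $e$ of $T$ and, for every left edge (resp. right edge) $e$, $n_e$ is the number of left edges (resp. right edges) contained in the subtree whose root is the ending point of $e$, plus $1$.
   Context: A binary tree is a finite nonempty rooted tree in which each vertex has at most one left child and at most one right child (considered up to isomorphism); edges are oriented away from the root, and an edge to a left (resp. right) child is a left (resp. right) edge. $V_L$ (resp. $V_R$) is the set of end points of left (resp. right) edges, identified with the set of left (resp. right) edges. $\mathbb{N}=\{0,1,2,\dots\}$. For a point $p\in\mathbb{N}\times\mathbb{N}$ write $p=(X(p),Y(p))$. A row is a set of points with fixed $X$, a column a set of points with fixed $Y$. A non-ambiguous tree of size $n$ is a set $A$ of $n$ points of $\mathbb{N}\times\mathbb{N}$ such that: (1) $(0,0)\in A$ (the root); (2) for each non-root $p\in A$, exactly one of the following holds: there is $q\in A$ with $X(q)=X(p)$, $Y(q)<Y(p)$; there is $r\in A$ with $Y(r)=Y(p)$, $X(r)<X(p)$; (3) if some $p\in A$ has $X(p)=x$ (resp. $Y(p)=y$), then for every $0\le x'<x$ (resp. $0\le y'<y$) some $q\in A$ has $X(q)=x'$ (resp. $Y(q)=y'$). The underlying binary tree of $A$ has vertex set $A$ and root $(0,0)$; the parent of a non-root $p$ is the nearest point of $A$ preceding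 $p$ in its row (then $p$ is a right child) or in its column (then $p$ is a left child). *)

theory Defs
  imports Complex_Main "HOL-Library.Tree"
begin

text \<open>A binary tree up to isomorphism is a \<^typ>\<open>unit tree\<close> other than \<^term>\<open>Leaf\<close>; here
  \<^term>\<open>Leaf\<close> stands for an absent child, not for a vertex.  A vertex is named by the path of
  left and right turns that leads to it from the root.\<close>

datatype side = Lft | Rgt

fun subtree_at :: "unit tree \<Rightarrow> side list \<Rightarrow> unit tree" where
  "subtree_at t [] = t"
| "subtree_at Leaf (s # v) = Leaf"
| "subtree_at (Node l a r) (Lft # v) = subtree_at l v"
| "subtree_at (Node l a r) (Rgt # v) = subtree_at r v"

definition vertices :: "unit tree \<Rightarrow> side list set" where
  "vertices t = {v. subtree_at t v \<noteq> Leaf}"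

text \<open>An edge is identified with its end point.\<close>

definition left_edges :: "unit tree \<Rightarrow> side list set" where
  "left_edges t = {v \<in> vertices t. \<exists>u. v = u @ [Lft]}"

definition right_edges :: "unit tree \<Rightarrow> side list set" where
  "right_edges t = {v \<in> vertices t. \<exists>u. v = u @ [Rgt]}"

definition n_left :: "unit tree \<Rightarrow> side list \<Rightarrow> nat" where
  "n_left t e = card (left_edges (subtree_at t e)) + 1"

definition n_right :: "unit tree \<Rightarrow> side list \<Rightarrow> nat" where
  "n_right t e = card (right_edges (subtree_at t e)) + 1"

text \<open>For a point \<open>p\<close>, \<open>X(p)\<close> is \<^term>\<open>fst p\<close> and \<open>Y(p)\<close> is \<^term>\<open>snd p\<close>; a row has constant
  first coordinate and a column has constant second coordinate.\<close>

definition non_ambiguous_tree :: "(nat \<times> nat) set \<Rightarrow> bool" where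
  "non_ambiguous_tree A \<longleftrightarrow>
     finite A \<and>
     (0, 0) \<in> A \<and>
     (\<forall>p \<in> A - {(0, 0)}.
        (\<exists>q \<in> A. fst q = fst p \<and> snd q < snd p) \<noteq>
        (\<exists>r \<in> A. snd r = snd p \<and> fst r < fst p)) \<and>
     (\<forall>p \<in> A. \<forall>x < fst p. \<exists>q \<in> A. fst q = x) \<and>
     (\<forall>p \<in> A. \<forall>y < snd p. \<exists>q \<in> A. snd q = y)"

text \<open>\<open>q\<close> is the nearest point of \<open>A\<close> preceding \<open>p\<close> in its row (right child), respectively in its
  column (left child).\<close>

definition is_right_child :: "(nat \<times> nat) set \<Rightarrow> nat \<times> nat \<Rightarrow> nat \<times> nat \<Rightarrow> bool" where
  "is_right_child A q p \<longleftrightarrow>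
     p \<in> A \<and> q \<in> A \<and> fst q = fst p \<and> snd q < snd p \<and>
     (\<forall>r \<in> A. fst r = fst p \<and> snd r < snd p \<longrightarrow> snd r \<le> snd q)"

definition is_left_child :: "(nat \<times> nat) set \<Rightarrow> nat \<times> nat \<Rightarrow> nat \<times> nat \<Rightarrow> bool" where
  "is_left_child A q p \<longleftrightarrow>
     p \<in> A \<and> q \<in> A \<and> snd q = snd p \<and> fst q < fst p \<and>
     (\<forall>r \<in> A. snd r = snd p \<and> fst r < fst p \<longrightarrow> fst r \<le> fst q)"

text \<open>The binary tree carried by \<open>A\<close> is isomorphic to \<open>t\<close>.\<close>

definition has_underlying_tree :: "(nat \<times> nat) set \<Rightarrow> unit tree \<Rightarrow> bool" where
  "has_underlying_tree A t \<longleftrightarrow>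
     (\<exists>f. bij_betw f A (vertices t) \<and> f (0, 0) = [] \<and>
        (\<forall>q \<in> A. \<forall>p \<in> A. is_left_child A q p \<longleftrightarrow> f p = f q @ [Lft]) \<and>
        (\<forall>q \<in> A. \<forall>p \<in> A. is_right_child A q p \<longleftrightarrow> f p = f q @ [Rgt]))"

definition NA :: "unit tree \<Rightarrow> nat" where
  "NA t = card {A. non_ambiguous_tree A \<and> has_underlying_tree A t}"

end

theory Submission
  imports Defs "HOL-Library.Prefix_Order" "HOL-Library.FuncSet"
begin

text \<open>In a non-ambiguous tree the first point of every row other than the row of the root is a left
  child, and the rest of the row consists of successive right descendants of it.  So the rows number
  the left edges, the columns number the right edges, both numberings increase away from the root,
  and they determine the points.  Conversely any two such numberings give a non-ambiguous tree.  Each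
  kind of numbering is an increasing labelling of a forest, counted by the hook length formula.\<close>

section \<open>Increasing labellings of a finite forest\<close>

text \<open>The value 0 off \<open>S\<close> makes a labelling determined by its restriction to
  \<open>S\<close>, so that counting total functions is meaningful. The offset \<open>k\<close> is
  free because deleting the element labelled \<open>k\<close> leaves labels that start at
  \<open>Suc k\<close>.\<close>

definition increasing_labellings :: "'a::order set \<Rightarrow> nat \<Rightarrow> ('a \<Rightarrow> nat) set" where
  "increasing_labellings S k =
     {a. bij_betw a S {k..<k + card S} \<and> strict_mono_on S a \<and> (\<forall>x. x \<notin> S \<longrightarrow> a x = 0)}"

definition minimal_elements :: "'a::order set \<Rightarrow> 'a set" where
  "minimal_elements S = {r \<in> S. \<forall>x\<in>S. \<not> x < r}"

lemma increasing_labellings_empty: "increasing_labellings {} k = {\<lambda>_. 0}"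
  by (auto simp: increasing_labellings_def bij_betw_def strict_mono_on_def)

text \<open>Minimality of \<open>r\<close> rules out \<open>x < r\<close>, and every label of
  \<open>b\<close> on \<open>S - {r}\<close> exceeds \<open>k\<close>, so the new value respects the
  order.\<close>

lemma increasing_labellings_insert_min:
  assumes "finite S" "r \<in> minimal_elements S" "b \<in> increasing_labellings (S - {r}) (Suc k)"
  shows "b(r := k) \<in> increasing_labellings S k"
proof -
  have r: "r \<in> S" "\<And>x. x \<in> S \<Longrightarrow> \<not> x < r"
    using assms(2) by (auto simp: minimal_elements_def)
  obtain n where card: "card S = Suc n" "card (S - {r}) = n"
    using card_Suc_Diff1[OF assms(1) r(1)] by metis
  have b: "bij_betw b (S - {r}) {Suc k..<k + card S}" "strict_mono_on (S - {r}) b"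
    "\<And>x. x \<notin> S \<Longrightarrow> b x = 0"
    using assms(3) by (auto simp: increasing_labellings_def card)
  have gt: "k < b x" if "x \<in> S" "x \<noteq> r" for x
    using bij_betwE[OF b(1)] that by (auto simp: Suc_le_eq)
  have "bij_betw (b(r := k)) (S - {r}) {Suc k..<k + card S}"
    using b(1) by (rule bij_betw_cong[THEN iffD1, rotated]) simp
  then have "bij_betw (b(r := k)) (S - {r} \<union> {r}) ({Suc k..<k + card S} \<union> {(b(r := k)) r})"
    by (intro notIn_Un_bij_betw) simp_all
  moreover have "S - {r} \<union> {r} = S" "{Suc k..<k + card S} \<union> {k} = {k..<k + card S}"
    using r(1) by (auto simp: card)
  ultimately have "bij_betw (b(r := k)) S {k..<k + card S}"
    by (simp only: fun_upd_same)
  moreover have "strict_mono_on S (b(r := k))"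
    using b(2) gt r(2) by (auto simp: strict_mono_on_def)
  ultimately show ?thesis
    using b(3) r(1) by (auto simp: increasing_labellings_def)
qed

text \<open>The element carrying the least label \<open>k\<close> is minimal, since anything below
  it would need a smaller label.\<close>

lemma increasing_labellings_remove_min:
  assumes "finite S" "S \<noteq> {}" "a \<in> increasing_labellings S k"
  obtains r b where "r \<in> minimal_elements S" "b \<in> increasing_labellings (S - {r}) (Suc k)"
    "a = b(r := k)"
proof -
  have a: "bij_betw a S {k..<k + card S}" "strict_mono_on S a" "\<And>x. x \<notin> S \<Longrightarrow> a x = 0"
    using assms(3) by (auto simp: increasing_labellings_def)
  have "0 < card S"
    using assms by (simp add: card_gt_0_iff)
  then have "k \<in> a ` S"
    using a(1) by (simp add: bij_betw_def)
  then obtain r where r: "r \<in> S" "a r = k"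
    by auto
  obtain n where card: "card S = Suc n" "card (S - {r}) = n"
    using card_Suc_Diff1[OF assms(1) r(1)] by metis
  have ge: "k \<le> a x" if "x \<in> S" for x
    using bij_betwE[OF a(1)] that by auto
  have "r \<in> minimal_elements S"
    using r ge a(2) unfolding minimal_elements_def strict_mono_on_def
    by (auto simp: not_less[symmetric])
  \<comment> \<open>Resetting the value at \<open>r\<close> to 0 restores the convention for
    elements outside the domain.\<close>
  moreover have "a(r := 0) \<in> increasing_labellings (S - {r}) (Suc k)"
  proof -
    have "bij_betw a (S - {r}) ({k..<k + card S} - {k})"
      using bij_betw_DiffI[OF a(1), of "{r}" "{k}"] r \<open>0 < card S\<close> by (simp add: bij_betw_def)
    moreover have "{k..<k + card S} - {k} = {Suc k..<Suc k + card (S - {r})}"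
      by (auto simp: card)
    ultimately have "bij_betw (a(r := 0)) (S - {r}) {Suc k..<Suc k + card (S - {r})}"
      by (subst bij_betw_cong[of _ _ a]) auto
    then show ?thesis
      using a by (auto simp: increasing_labellings_def strict_mono_on_def)
  qed
  moreover have "a = (a(r := 0))(r := k)"
    using r(2) by auto
  ultimately show thesis
    by (rule that)
qed

lemma increasing_labellings_rec:
  assumes "finite S" "S \<noteq> {}"
  shows "increasing_labellings S k =
    (\<Union>r\<in>minimal_elements S. (\<lambda>b. b(r := k)) ` increasing_labellings (S - {r}) (Suc k))"
proof (intro set_eqI iffI)
  fix a assume "a \<in> increasing_labellings S k"
  from increasing_labellings_remove_min[OF assms this]
  show "a \<in> (\<Union>r\<in>minimal_elements S. (\<lambda>b. b(r := k)) ` increasing_labellings (S - {r}) (Suc k))"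
    by blast
qed (use increasing_labellings_insert_min[OF assms(1)] in blast)

lemma finite_increasing_labellings:
  "finite S \<Longrightarrow> finite (increasing_labellings S k)"
proof (induction "card S" arbitrary: S k)
  case 0
  then show ?case by (simp add: increasing_labellings_empty)
next
  case (Suc n)
  then have "S \<noteq> {}" by auto
  with Suc show ?case
    by (subst increasing_labellings_rec) (auto simp: minimal_elements_def)
qed

text \<open>The union in the recursion is disjoint: \<open>r\<close> is recovered from a labelling
  as the unique element of \<open>S\<close> with label \<open>k\<close>.\<close>

lemma card_increasing_labellings_rec:
  assumes "finite S" "S \<noteq> {}"
  shows "card (increasing_labellings S k) =
    (\<Sum>r\<in>minimal_elements S. card (increasing_labellings (S - {r}) (Suc k)))"
proof -
  let ?F = "\<lambda>r. (\<lambda>b. b(r := k)) ` increasing_labellings (S - {r}) (Suc k)"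
  have fin: "finite (minimal_elements S)"
    using assms(1) by (simp add: minimal_elements_def)
  have eq: "r = r'" if "r \<in> minimal_elements S" "r' \<in> minimal_elements S" "a \<in> ?F r" "a \<in> ?F r'" for r r' a
  proof -
    have "a r = k" "a r' = k"
      using that(3,4) by (metis (lifting) fun_upd_same imageE)+
    moreover have "r \<in> S" "r' \<in> S"
      using that(1,2) by (auto simp: minimal_elements_def)
    moreover have "a \<in> increasing_labellings S k"
      using that(1,3) increasing_labellings_rec[OF assms] by blast
    ultimately show ?thesis
      by (auto simp: increasing_labellings_def bij_betw_def dest: inj_onD)
  qed
  have "card (increasing_labellings S k) = (\<Sum>r\<in>minimal_elements S. card (?F r))"
    unfolding increasing_labellings_rec[OF assms]
  proof (rule card_UN_disjoint)
    show "\<forall>r\<in>minimal_elements S. \<forall>r'\<in>minimal_elements S. r \<noteq> r' \<longrightarrow> ?F r \<inter> ?F r' = {}"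
      using eq by (meson disjoint_iff)
  qed (use fin assms(1) in \<open>simp_all add: finite_increasing_labellings\<close>)
  also have "\<dots> = (\<Sum>r\<in>minimal_elements S. card (increasing_labellings (S - {r}) (Suc k)))"
  proof (rule sum.cong[OF refl], rule card_image, rule inj_onI)
    fix r a b assume *: "a \<in> increasing_labellings (S - {r}) (Suc k)"
      "b \<in> increasing_labellings (S - {r}) (Suc k)" "a(r := k) = b(r := k)"
    \<comment> \<open>Both are 0, as \<open>r\<close> lies outside \<open>S - {r}\<close>; hence the
      update at \<open>r\<close> loses no information.\<close>
    then have "a r = b r"
      by (simp add: increasing_labellings_def)
    with *(3) show "a = b"
      by (metis fun_upd_triv fun_upd_upd)
  qed
  finally show ?thesis .
qed

text \<open>By finiteness every element lies above a minimal one, and by the forest condition two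
  minimal elements with a common upper bound are comparable, hence equal.\<close>

lemma sum_card_above_minimal:
  assumes "finite S"
    and forest: "\<And>x y z. \<lbrakk>x \<in> S; y \<in> S; z \<in> S; x \<le> z; y \<le> z\<rbrakk> \<Longrightarrow> x \<le> y \<or> y \<le> x"
  shows "(\<Sum>r\<in>minimal_elements S. card {y\<in>S. r \<le> y}) = card S"
proof -
  have "S = (\<Union>r\<in>minimal_elements S. {y\<in>S. r \<le> y})"
    using finite_has_minimal2[OF assms(1)] by (fastforce simp: minimal_elements_def)
  then have "card S = card (\<Union>r\<in>minimal_elements S. {y\<in>S. r \<le> y})"
    by simp
  also have "\<dots> = (\<Sum>r\<in>minimal_elements S. card {y\<in>S. r \<le> y})"
  proof (rule card_UN_disjoint)
    show "\<forall>r\<in>minimal_elements S. \<forall>r'\<in>minimal_elements S. r \<noteq> r' \<longrightarrow>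
        {y\<in>S. r \<le> y} \<inter> {y\<in>S. r' \<le> y} = {}"
      using forest by (auto simp: minimal_elements_def order.order_iff_strict) blast+
  qed (use assms(1) in \<open>auto simp: minimal_elements_def\<close>)
  finally show ?thesis ..
qed

text \<open>Removing the element with the least label does not change the hooks of the others, and
  the hooks of the minimal elements partition the forest.\<close>

theorem forest_hook_length:
  assumes "finite S"
    and "\<And>x y z. \<lbrakk>x \<in> S; y \<in> S; z \<in> S; x \<le> z; y \<le> z\<rbrakk> \<Longrightarrow> x \<le> y \<or> y \<le> x"
  shows "card (increasing_labellings S k) * (\<Prod>x\<in>S. card {y\<in>S. x \<le> y}) = fact (card S)"
  using assms
proof (induction "card S" arbitrary: S k)
  case 0
  then show ?case by (simp add: increasing_labellings_empty)
next
  case (Suc n)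
  let ?h = "\<lambda>x. card {y\<in>S. x \<le> y}"
  have "S \<noteq> {}"
    using Suc.hyps(2) by auto
  \<comment> \<open>Multiplying by the hook product of all of \<open>S\<close> avoids division: the
    induction hypothesis absorbs every factor except that of \<open>r\<close>.\<close>
  have step: "card (increasing_labellings (S - {r}) (Suc k)) * (\<Prod>x\<in>S. ?h x) = ?h r * fact n"
    if "r \<in> minimal_elements S" for r
  proof -
    have r: "r \<in> S" "\<And>x. x \<in> S \<Longrightarrow> \<not> x < r"
      using that by (auto simp: minimal_elements_def)
    have "{y \<in> S - {r}. x \<le> y} = {y\<in>S. x \<le> y}" if "x \<in> S - {r}" for x
      using r(2) that by (auto simp: order.order_iff_strict)
    then have "(\<Prod>x\<in>S - {r}. card {y \<in> S - {r}. x \<le> y}) = (\<Prod>x\<in>S - {r}. ?h x)"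
      by (intro prod.cong) simp_all
    moreover have "card (S - {r}) = n"
      using Suc.hyps(2) r(1) Suc.prems(1) by simp
    moreover have "card (increasing_labellings (S - {r}) (Suc k)) *
        (\<Prod>x\<in>S - {r}. card {y \<in> S - {r}. x \<le> y}) = fact (card (S - {r}))"
      by (rule Suc.hyps(1)) (use calculation(2) Suc.prems in auto)
    ultimately have "card (increasing_labellings (S - {r}) (Suc k)) * (\<Prod>x\<in>S - {r}. ?h x) = fact n"
      by simp
    then show ?thesis
      by (simp add: prod.remove[OF Suc.prems(1) r(1)] mult.left_commute)
  qed
  have "card (increasing_labellings S k) * (\<Prod>x\<in>S. ?h x)
      = (\<Sum>r\<in>minimal_elements S. ?h r * fact n)"
    unfolding card_increasing_labellings_rec[OF Suc.prems(1) \<open>S \<noteq> {}\<close>] sum_distrib_right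
    by (rule sum.cong[OF refl step])
  also have "\<dots> = card S * fact n"
    using sum_card_above_minimal[OF Suc.prems] by (simp flip: sum_distrib_right)
  finally show ?case
    by (simp flip: Suc.hyps(2))
qed

section \<open>Binary trees as sets of paths\<close>

text \<open>The reflection that exchanges rows and columns. With the side as a parameter, one
  argument covers left and right edges.\<close>

fun opposite :: "side \<Rightarrow> side" where
  "opposite Lft = Rgt"
| "opposite Rgt = Lft"

definition edges :: "side \<Rightarrow> unit tree \<Rightarrow> side list set" where
  "edges s t = {v \<in> vertices t. \<exists>u. v = u @ [s]}"

lemma left_edges_eq: "left_edges t = edges Lft t"
  and right_edges_eq: "right_edges t = edges Rgt t"
  by (simp_all add: left_edges_def right_edges_def edges_def)

lemma opposite_opposite [simp]: "opposite (opposite s) = s"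
  and opposite_neq [simp]: "opposite s \<noteq> s" "s \<noteq> opposite s"
  and eq_opposite_iff: "s' = opposite s \<longleftrightarrow> s' \<noteq> s"
  by (cases s; cases s'; simp)+

lemma subtree_at_Leaf [simp]: "subtree_at Leaf v = Leaf"
  by (cases v) auto

lemma subtree_at_append: "subtree_at t (u @ v) = subtree_at (subtree_at t u) v"
  by (induction t u rule: subtree_at.induct) auto

lemma vertices_Leaf [simp]: "vertices Leaf = {}"
  by (simp add: vertices_def)

lemma Nil_in_vertices: "t \<noteq> Leaf \<Longrightarrow> [] \<in> vertices t"
  by (simp add: vertices_def)

lemma append_in_vertices_iff: "u @ v \<in> vertices t \<longleftrightarrow> v \<in> vertices (subtree_at t u)"
  by (simp add: vertices_def subtree_at_append)

lemma vertices_prefix: "u @ v \<in> vertices t \<Longrightarrow> u \<in> vertices t"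
  by (auto simp: vertices_def subtree_at_append)

lemma finite_vertices: "finite (vertices t)"
proof (induction t)
  case (Node l a r)
  have "vertices (Node l a r) \<subseteq> insert [] ((#) Lft ` vertices l \<union> (#) Rgt ` vertices r)"
  proof
    fix v assume "v \<in> vertices (Node l a r)"
    then show "v \<in> insert [] ((#) Lft ` vertices l \<union> (#) Rgt ` vertices r)"
      by (cases "(Node l a r, v)" rule: subtree_at.cases) (auto simp: vertices_def)
  qed
  with Node show ?case
    by (auto intro: finite_subset)
qed simp

lemma Nil_notin_edges: "[] \<notin> edges s t"
  by (simp add: edges_def)

lemma finite_edges: "finite (edges s t)"
  by (simp add: edges_def finite_vertices)

text \<open>Prepending \<open>e\<close> carries the \<open>s\<close>-edges of the subtree onto the
  \<open>s\<close>-edges that properly extend \<open>e\<close>; the summand 1 counts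
  \<open>e\<close> itself. Thus the number attached to \<open>e\<close> is its hook in the prefix
  order.\<close>

lemma card_edges_subtree:
  assumes "e \<in> edges s t"
  shows "card (edges s (subtree_at t e)) + 1 = card {v \<in> edges s t. e \<le> v}"
proof -
  have "bij_betw ((@) e) (edges s (subtree_at t e)) {v \<in> edges s t. e < v}"
    unfolding bij_betw_def
  proof
    show "(@) e ` edges s (subtree_at t e) = {v \<in> edges s t. e < v}"
    proof (intro set_eqI iffI)
      fix v assume "v \<in> {v \<in> edges s t. e < v}"
      then obtain u w where "v = e @ w" "w \<noteq> []" "v = u @ [s]" "v \<in> vertices t"
        by (auto simp: edges_def less_list_def' strict_prefix_def prefix_def)
      moreover from this obtain w' where "w = w' @ [s]"
        by (metis append_butlast_last_id last_appendR last_snoc)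
      ultimately show "v \<in> (@) e ` edges s (subtree_at t e)"
        by (auto simp: edges_def append_in_vertices_iff)
    qed (auto simp: edges_def append_in_vertices_iff less_list_def' strict_prefix_def)
  qed (simp add: inj_on_def)
  then have "card (edges s (subtree_at t e)) = card {v \<in> edges s t. e < v}"
    by (rule bij_betw_same_card)
  moreover have "{v \<in> edges s t. e \<le> v} = insert e {v \<in> edges s t. e < v}"
    using assms by auto
  ultimately show ?thesis
    by (simp add: finite_edges)
qed

text \<open>Two prefixes of one path are comparable, so the edges of one side form a forest under
  the prefix order and the hook length formula applies.\<close>

lemma card_increasing_labellings_edges:
  "real (card (increasing_labellings (edges s t) k)) =
     fact (card (edges s t)) / (\<Prod>e\<in>edges s t. real (card (edges s (subtree_at t e)) + 1))"
proof -
  have "card (increasing_labellings (edges s t) k) * (\<Prod>e\<in>edges s t. card {v \<in> edges s t. e \<le> v})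
      = fact (card (edges s t))"
    by (rule forest_hook_length) (auto simp: finite_edges less_eq_list_def prefix_same_cases)
  moreover have "(\<Prod>e\<in>edges s t. card {v \<in> edges s t. e \<le> v}) =
      (\<Prod>e\<in>edges s t. card (edges s (subtree_at t e)) + 1)"
    by (rule prod.cong[OF refl]) (rule card_edges_subtree[symmetric])
  ultimately have "real (card (increasing_labellings (edges s t) k) *
      (\<Prod>e\<in>edges s t. card (edges s (subtree_at t e)) + 1)) = fact (card (edges s t))"
    by (metis of_nat_fact)
  then show ?thesis
    by (subst nonzero_eq_divide_eq) (simp_all add: finite_edges)
qed

section \<open>Points labelled by the vertices of a tree\<close>

text \<open>\<open>coord s\<close> is the coordinate that grows along an \<open>s\<close>-edge;
  \<open>coord (opposite s)\<close> stays constant along it.\<close>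

fun coord :: "side \<Rightarrow> nat \<times> nat \<Rightarrow> nat" where
  "coord Lft p = fst p"
| "coord Rgt p = snd p"

lemma point_eqI: "(\<And>s. coord s p = coord s q) \<Longrightarrow> p = q"
  by (metis coord.simps prod_eqI)

lemma coord_origin [simp]: "coord s (0, 0) = 0"
  by (cases s) auto

definition precedes :: "side \<Rightarrow> nat \<times> nat \<Rightarrow> nat \<times> nat \<Rightarrow> bool" where
  "precedes s q p \<longleftrightarrow> coord (opposite s) q = coord (opposite s) p \<and> coord s q < coord s p"

definition is_child :: "side \<Rightarrow> (nat \<times> nat) set \<Rightarrow> nat \<times> nat \<Rightarrow> nat \<times> nat \<Rightarrow> bool" where
  "is_child s A q p \<longleftrightarrow> p \<in> A \<and> q \<in> A \<and> precedes s q p \<and>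
     (\<forall>r\<in>A. precedes s r p \<longrightarrow> coord s r \<le> coord s q)"

lemma all_side_iff: "(\<forall>s. P s) \<longleftrightarrow> P Lft \<and> P Rgt"
  by (metis side.exhaust)

lemma is_left_child_eq: "is_left_child = is_child Lft"
  and is_right_child_eq: "is_right_child = is_child Rgt"
  by (auto simp: fun_eq_iff is_left_child_def is_right_child_def is_child_def precedes_def)

lemma has_underlying_tree_iff:
  "has_underlying_tree A t \<longleftrightarrow>
     (\<exists>f. bij_betw f A (vertices t) \<and> f (0, 0) = [] \<and>
        (\<forall>s. \<forall>q\<in>A. \<forall>p\<in>A. is_child s A q p \<longleftrightarrow> f p = f q @ [s]))"
  unfolding has_underlying_tree_def is_left_child_eq is_right_child_eq all_side_iff by simp

lemma non_ambiguous_tree_iff: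
  "non_ambiguous_tree A \<longleftrightarrow>
     finite A \<and> (0, 0) \<in> A \<and>
     (\<forall>p\<in>A - {(0, 0)}. \<exists>!s. \<exists>q\<in>A. precedes s q p) \<and>
     (\<forall>s. \<forall>p\<in>A. \<forall>x<coord s p. \<exists>q\<in>A. coord s q = x)"
proof -
  \<comment> \<open>Inequality of truth values is exclusive or, which over the two sides means a
    unique side.\<close>
  have "(\<exists>!s. P s) \<longleftrightarrow> P Rgt \<noteq> P Lft" for P
    by (metis side.exhaust side.distinct(1))
  then show ?thesis
    unfolding non_ambiguous_tree_def all_side_iff
    by (simp add: precedes_def conj_commute)
qed

text \<open>Two \<open>s\<close>-children of \<open>q\<close> lie on one line. If they were
  distinct, the nearer one would lie strictly between \<open>q\<close> and the farther one, so
  \<open>q\<close> would not be the nearest predecessor of the latter.\<close>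

lemma is_child_unique: "is_child s A q p \<Longrightarrow> is_child s A q p' \<Longrightarrow> p = p'"
proof (rule point_eqI)
  fix s' assume *: "is_child s A q p" "is_child s A q p'"
  then have "coord (opposite s) p = coord (opposite s) p'"
    by (simp add: is_child_def precedes_def)
  moreover from this have "\<not> coord s p < coord s p'" "\<not> coord s p' < coord s p"
    using * by (fastforce simp: is_child_def precedes_def)+
  ultimately show "coord s' p = coord s' p'"
    by (cases "s' = s") (auto simp: eq_opposite_iff[symmetric])
qed

text \<open>\<open>strip s v\<close> is the first vertex of the maximal chain of \<open>s\<close>-edges through \<open>v\<close>.\<close>

definition strip :: "side \<Rightarrow> side list \<Rightarrow> side list" where
  "strip s v = rev (dropWhile ((=) s) (rev v))"

lemma strip_Nil [simp]: "strip s [] = []"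
  by (simp add: strip_def)

lemma strip_snoc [simp]: "strip s (v @ [s']) = (if s' = s then strip s v else v @ [s'])"
  by (auto simp: strip_def)

lemma strip_decomp: "\<exists>k. v = strip s v @ replicate k s"
proof (induction v rule: rev_induct)
  case (snoc x v)
  then obtain k where k: "v = strip s v @ replicate k s" by auto
  show ?case
  proof (cases "x = s")
    case True
    then have "v @ [x] = strip s (v @ [x]) @ replicate (Suc k) s"
      using k by (simp add: replicate_append_same[symmetric])
    then show ?thesis by blast
  next
    case False
    then have "v @ [x] = strip s (v @ [x]) @ replicate 0 s" by simp
    then show ?thesis by blast
  qed
qed simp

lemma strip_le: "strip s v \<le> v"
  using strip_decomp[of v s] by (metis less_eq_list_def prefixI)

text \<open>A maximal chain of edges opposite to \<open>s\<close> starts at the root or at the end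
  of an \<open>s\<close>-edge. These starting points therefore index the lines on which
  \<open>coord s\<close> is constant.\<close>

lemma strip_in_edges:
  assumes "v \<in> vertices t"
  shows "strip (opposite s) v \<in> insert [] (edges s t)"
  using assms
proof (induction v rule: rev_induct)
  case (snoc x v)
  then show ?case
    using vertices_prefix[of v "[x]" t] by (cases x; cases s) (auto simp: edges_def)
qed simp

lemma strip_edge: "v \<in> edges s t \<Longrightarrow> strip (opposite s) v = v"
  by (auto simp: edges_def)

text \<open>The row of \<open>v\<close> is the label of the vertex that starts its chain of right
  edges, the column that of the vertex starting its chain of left edges.\<close>

definition position :: "(side \<Rightarrow> side list \<Rightarrow> nat) \<Rightarrow> side list \<Rightarrow> nat \<times> nat" where
  "position a v = (a Lft (strip Rgt v), a Rgt (strip Lft v))"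

lemma coord_position [simp]: "coord s (position a v) = a s (strip (opposite s) v)"
  by (cases s) (auto simp: position_def)

section \<open>From labellings to non-ambiguous trees\<close>

text \<open>Labels start at 1 because 0, the default value taken at \<open>[]\<close>, is the row
  and column of the root.\<close>

locale labelled_tree =
  fixes t :: "unit tree" and a :: "side \<Rightarrow> side list \<Rightarrow> nat"
  assumes nonempty: "t \<noteq> Leaf"
    and labelling: "a s \<in> increasing_labellings (edges s t) 1"
begin

abbreviation points :: "(nat \<times> nat) set" where
  "points \<equiv> position a ` vertices t"

lemma label_bij: "bij_betw (a s) (edges s t) {1..card (edges s t)}"
  using labelling[of s] by (simp add: increasing_labellings_def atLeastLessThanSuc_atLeastAtMost)

lemma label_outside: "v \<notin> edges s t \<Longrightarrow> a s v = 0"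
  using labelling[of s] by (simp add: increasing_labellings_def)

lemma label_pos: "v \<in> edges s t \<Longrightarrow> 0 < a s v"
  using bij_betwE[OF label_bij] by fastforce

text \<open>The default 0 at \<open>[]\<close> does not collide with an edge label, so distinct
  chains receive distinct lines.\<close>

lemma label_inj: "inj_on (a s) (insert [] (edges s t))"
  using label_bij[of s] label_pos[of _ s] label_outside[OF Nil_notin_edges, of s]
  by (fastforce simp: bij_betw_def)

lemma label_image: "a s ` insert [] (edges s t) = {..card (edges s t)}"
  using label_bij[of s] label_outside[OF Nil_notin_edges, of s] by (auto simp: bij_betw_def)

lemma label_less:
  assumes "u \<in> insert [] (edges s t)" "w \<in> edges s t" "u < w"
  shows "a s u < a s w"
  using assms labelling[of s] label_pos[OF assms(2)] label_outside[OF Nil_notin_edges, of s]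
  by (auto simp: increasing_labellings_def strict_mono_on_def)

text \<open>Appending \<open>s\<close> keeps the chain of \<open>s\<close>-edges, hence one
  coordinate. The other becomes the label of the new edge, which properly extends the start of the
  former chain and so has the larger label.\<close>

lemma precedes_snoc:
  assumes "v @ [s] \<in> vertices t"
  shows "precedes s (position a v) (position a (v @ [s]))"
proof -
  have "v @ [s] \<in> edges s t"
    using assms by (simp add: edges_def)
  moreover have "strip (opposite s) v < v @ [s]"
    using strip_le[of "opposite s" v] by (rule order.strict_trans1) (simp add: less_list_def' strict_prefix_def)
  ultimately have "a s (strip (opposite s) v) < a s (v @ [s])"
    using strip_in_edges[OF vertices_prefix[OF assms]] by (intro label_less)
  then show ?thesis
    by (simp add: precedes_def)
qed

lemma precedes_replicate:
  "v @ replicate (Suc k) s \<in> vertices t \<Longrightarrow>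
     precedes s (position a v) (position a (v @ replicate (Suc k) s))"
proof (induction k)
  case 0
  then show ?case using precedes_snoc by simp
next
  case (Suc k)
  let ?w = "v @ replicate (Suc k) s"
  have eq: "v @ replicate (Suc (Suc k)) s = ?w @ [s]"
    by (simp add: replicate_append_same)
  have *: "?w @ [s] \<in> vertices t"
    using Suc.prems unfolding eq .
  show ?case
    using Suc.IH[OF vertices_prefix[OF *]] precedes_snoc[OF *] unfolding eq precedes_def by simp
qed

text \<open>By injectivity of the labels, equal coordinates mean equal starting points of the chains
  of \<open>s\<close>-edges, and two vertices of one chain differ by a block of letters
  \<open>s\<close>.\<close>

lemma same_line:
  assumes "v \<in> vertices t" "w \<in> vertices t"
    and "coord (opposite s) (position a v) = coord (opposite s) (position a w)"
  shows "v = w \<or> (\<exists>k. w = v @ replicate (Suc k) s) \<or> (\<exists>k. v = w @ replicate (Suc k) s)"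
proof -
  have "strip s v = strip s w"
    using assms inj_onD[OF label_inj[of "opposite s"], of "strip s v" "strip s w"]
      strip_in_edges[of _ t "opposite s"] by simp
  then obtain i j where v: "v = strip s v @ replicate i s" and w: "w = strip s v @ replicate j s"
    using strip_decomp[of v s] strip_decomp[of w s] by metis
  have extend: "strip s v @ replicate m s = (strip s v @ replicate l s) @ replicate (Suc (m - Suc l)) s"
    if "l < m" for l m
    using that by (simp del: replicate_Suc flip: replicate_add)
  show ?thesis
    using v w extend by (metis linorder_less_linear)
qed

text \<open>Agreement in one coordinate puts both vertices on one chain, along which the other
  coordinate strictly increases.\<close>

lemma inj_position: "inj_on (position a) (vertices t)"
proof (rule inj_onI)
  fix v w assume *: "v \<in> vertices t" "w \<in> vertices t" "position a v = position a w"
  then show "v = w"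
    using same_line[of v w Lft] precedes_replicate by (metis order.irrefl precedes_def)
qed

lemma precedes_iff:
  assumes "v \<in> vertices t" "w \<in> vertices t"
  shows "precedes s (position a v) (position a w) \<longleftrightarrow> (\<exists>k. w = v @ replicate (Suc k) s)"
proof
  assume *: "precedes s (position a v) (position a w)"
  then show "\<exists>k. w = v @ replicate (Suc k) s"
    using same_line[OF assms, of s] precedes_replicate[of w _ s] assms(1)
    by (metis order.asym precedes_def)
qed (use assms precedes_replicate in auto)

lemma is_child_iff:
  assumes v: "v \<in> vertices t" and w: "w \<in> vertices t"
  shows "is_child s points (position a v) (position a w) \<longleftrightarrow> w = v @ [s]"
proof
  assume child: "is_child s points (position a v) (position a w)"
  then obtain k where k: "w = v @ replicate (Suc k) s"
    using precedes_iff[OF v w] by (auto simp: is_child_def)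
  show "w = v @ [s]"
  proof (cases k)
    case (Suc l)
    \<comment> \<open>The vertex just before \<open>w\<close> on the chain would be a nearer
      predecessor of \<open>w\<close> than \<open>v\<close>.\<close>
    let ?u = "v @ replicate (Suc l) s"
    have "w = ?u @ [s]"
      using k Suc by (simp add: replicate_append_same)
    moreover from this have u: "?u \<in> vertices t"
      using w vertices_prefix by metis
    ultimately have "precedes s (position a ?u) (position a w)"
      using w precedes_snoc by metis
    then have "coord s (position a ?u) \<le> coord s (position a v)"
      using child u by (auto simp: is_child_def)
    with precedes_replicate[OF u] show ?thesis
      by (simp add: precedes_def)
  qed (use k in simp)
next
  assume eq: "w = v @ [s]"
  \<comment> \<open>A predecessor \<open>u\<close> of \<open>w\<close> lies on the chain at or
    before \<open>v\<close>.\<close>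
  have "coord s (position a u) \<le> coord s (position a v)"
    if u: "u \<in> vertices t" "precedes s (position a u) (position a w)" for u
  proof -
    obtain k where "w = u @ replicate (Suc k) s"
      using precedes_iff[OF u(1) w] u(2) by auto
    then have "v = u @ replicate k s"
      using eq by (simp add: replicate_append_same[symmetric])
    then show ?thesis
      using precedes_replicate[of u _ s] v by (cases k) (auto simp: precedes_def less_imp_le simp del: replicate_Suc)
  qed
  then show "is_child s points (position a v) (position a w)"
    using v w eq precedes_snoc by (auto simp: is_child_def)
qed

lemma position_Nil: "position a [] = (0, 0)"
  by (simp add: position_def label_outside Nil_notin_edges)

text \<open>A point has predecessors only in the direction of the last letter of its path, which
  gives the exactly-one condition. No line is empty because the labels together with 0 form an
  initial segment.\<close>

lemma non_ambiguous_tree_points: "non_ambiguous_tree points"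
  unfolding non_ambiguous_tree_iff
proof (intro conjI allI ballI impI)
  show "finite points"
    by (simp add: finite_vertices)
  show "(0, 0) \<in> points"
    using position_Nil Nil_in_vertices[OF nonempty] by (metis imageI)
next
  fix p assume "p \<in> points - {(0, 0)}"
  then obtain v where v: "v \<in> vertices t" "p = position a v" "v \<noteq> []"
    using position_Nil by auto
  then obtain u s where u: "v = u @ [s]"
    by (metis rev_exhaust)
  show "\<exists>!s. \<exists>q\<in>points. precedes s q p"
  proof (rule ex1I)
    show "\<exists>q\<in>points. precedes s q p"
      using v u precedes_snoc vertices_prefix by blast
  next
    fix s' assume "\<exists>q\<in>points. precedes s' q p"
    then obtain k w where "u @ [s] = w @ replicate (Suc k) s'"
      using v u precedes_iff by auto
    then show "s' = s"
      by (metis append_assoc last_snoc replicate_Suc replicate_append_same)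
  qed
next
  fix s p x assume "p \<in> points" "x < coord s p"
  then obtain v where v: "v \<in> vertices t" "x < a s (strip (opposite s) v)"
    by auto
  have "a s (strip (opposite s) v) \<in> {..card (edges s t)}"
    using label_image[of s] strip_in_edges[OF v(1), of s] by blast
  then have "x \<in> {..card (edges s t)}"
    using v(2) by simp
  then obtain w where w: "w \<in> insert [] (edges s t)" "x = a s w"
    unfolding label_image[symmetric] by auto
  then have "w \<in> vertices t"
    using Nil_in_vertices[OF nonempty] by (auto simp: edges_def)
  \<comment> \<open>The root and each \<open>s\<close>-edge start their own chain, so the label
    \<open>x\<close> of \<open>w\<close> is the coordinate of its position.\<close>
  moreover have "strip (opposite s) w = w"
    using w(1) strip_edge by auto
  ultimately show "\<exists>q\<in>points. coord s q = x"
    using w(2) by (intro bexI[of _ "position a w"]) auto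
qed

lemma has_underlying_tree_points: "has_underlying_tree points t"
  unfolding has_underlying_tree_iff
proof (intro exI conjI allI ballI)
  let ?f = "inv_into (vertices t) (position a)"
  show "bij_betw ?f points (vertices t)"
    using inj_position by (intro bij_betw_inv_into inj_on_imp_bij_betw)
  have f: "?f (position a v) = v" if "v \<in> vertices t" for v
    using inj_position that by (rule inv_into_f_f)
  show "?f (0, 0) = []"
    using f[of "[]"] Nil_in_vertices[OF nonempty] by (simp add: position_Nil)
  show "is_child s points q p \<longleftrightarrow> ?f p = ?f q @ [s]" if "q \<in> points" "p \<in> points" for s q p
    using that f is_child_iff by auto
qed

end

text \<open>The point set determines the positions by induction along paths: the root is at the
  origin, and each point has at most one \<open>s\<close>-child. Labels are then read off as
  coordinates of end points of edges.\<close>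

lemma position_image_inj:
  assumes a: "labelled_tree t a" and b: "labelled_tree t b"
    and eq: "position a ` vertices t = position b ` vertices t"
  shows "a = b"
proof -
  interpret a: labelled_tree t a by fact
  interpret b: labelled_tree t b by fact
  have same: "position a v = position b v" if "v \<in> vertices t" for v
    using that
  proof (induction v rule: rev_induct)
    case Nil
    show ?case by (simp add: a.position_Nil b.position_Nil)
  next
    case (snoc s v)
    then have v: "v \<in> vertices t"
      using vertices_prefix by blast
    have "is_child s a.points (position a v) (position a (v @ [s]))"
      using a.is_child_iff[OF v snoc.prems] by simp
    moreover have "is_child s b.points (position b v) (position b (v @ [s]))"
      using b.is_child_iff[OF v snoc.prems] by simp
    ultimately show ?case
      unfolding eq snoc.IH[OF v] by (rule is_child_unique)
  qed
  show ?thesis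
  proof (intro ext)
    fix s v show "a s v = b s v"
    proof (cases "v \<in> edges s t")
      case True
      then have "coord s (position a v) = coord s (position b v)"
        using same by (simp add: edges_def)
      then show ?thesis
        using True by (simp add: strip_edge)
    qed (simp add: a.label_outside b.label_outside)
  qed
qed

section \<open>From non-ambiguous trees to labellings\<close>

lemma initial_segment_eq:
  fixes N :: "nat set"
  assumes "finite N" and down: "\<And>x y. y \<in> N \<Longrightarrow> x < y \<Longrightarrow> x \<in> N"
  shows "N = {..<card N}"
proof (cases "N = {}")
  case False
  have "N = {..<Suc (Max N)}"
  proof (intro set_eqI iffI)
    fix x assume "x \<in> {..<Suc (Max N)}"
    then show "x \<in> N"
      using down[OF Max_in[OF assms(1) False]] Max_in[OF assms(1) False]
      by (cases "x = Max N") auto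
  qed (use assms(1) in \<open>simp add: less_Suc_eq_le\<close>)
  then show ?thesis
    by (metis card_lessThan)
qed simp

text \<open>Label each \<open>s\<close>-edge by the \<open>s\<close>-coordinate of its end point.
  The exactly-one condition makes the labels distinct, and the absence of empty lines makes them
  consecutive.\<close>

lemma labelling_exists:
  assumes A: "non_ambiguous_tree A" "has_underlying_tree A t"
  obtains a where "labelled_tree t a" "A = position a ` vertices t"
proof -
  obtain f where f: "bij_betw f A (vertices t)" "f (0, 0) = []"
    and child: "\<And>s q p. q \<in> A \<Longrightarrow> p \<in> A \<Longrightarrow> is_child s A q p \<longleftrightarrow> f p = f q @ [s]"
    using A(2) unfolding has_underlying_tree_iff by auto
  have A': "finite A" "(0, 0) \<in> A"
    "\<And>p. p \<in> A \<Longrightarrow> p \<noteq> (0, 0) \<Longrightarrow> \<exists>!s. \<exists>q\<in>A. precedes s q p"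
    "\<And>s p x. p \<in> A \<Longrightarrow> x < coord s p \<Longrightarrow> \<exists>q\<in>A. coord s q = x"
    using A(1) unfolding non_ambiguous_tree_iff by auto
  define g where "g = inv_into A f"
  have g: "bij_betw g (vertices t) A"
    unfolding g_def using f(1) by (rule bij_betw_inv_into)
  have fg: "f (g v) = v" if "v \<in> vertices t" for v
    unfolding g_def using f(1) that by (rule bij_betw_inv_into_right)
  have gA: "g v \<in> A" if "v \<in> vertices t" for v
    using g that by (rule bij_betw_apply)
  have g_Nil: "g [] = (0, 0)"
    using bij_betw_inv_into_left[OF f(1) A'(2)] f(2) by (simp add: g_def)
  have "f (0, 0) \<in> vertices t"
    using f(1) A'(2) by (rule bij_betw_apply)
  then have nonempty: "t \<noteq> Leaf"
    by auto
  have step: "precedes s (g v) (g (v @ [s]))" if "v @ [s] \<in> vertices t" for s v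
    using child[of "g v" "g (v @ [s])" s] that vertices_prefix[OF that]
    by (simp add: gA fg is_child_def)
  define a where "a = (\<lambda>s v. if v \<in> edges s t then coord s (g v) else 0)"
  \<comment> \<open>An edge of the opposite side leaves \<open>coord s\<close> unchanged, so only
    the first vertex of the chain matters.\<close>
  have strip: "coord s (g v) = a s (strip (opposite s) v)" if "v \<in> vertices t" for s v
    using that
  proof (induction v rule: rev_induct)
    case Nil
    show ?case by (simp add: g_Nil a_def edges_def)
  next
    case (snoc x v)
    show ?case
    proof (cases "x = s")
      case True
      with snoc.prems show ?thesis
        by (simp add: a_def edges_def)
    next
      case False
      then have x: "x = opposite s"
        by (simp add: eq_opposite_iff)
      show ?thesis
        using step[OF snoc.prems] snoc.IH[OF vertices_prefix[OF snoc.prems]]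
        by (simp add: x precedes_def)
    qed
  qed
  \<comment> \<open>A path between two \<open>s\<close>-edges may mix both sides, and each step
    raises one coordinate while fixing the other.\<close>
  have mono: "coord s (g u) \<le> coord s (g (u @ v))" if "u @ v \<in> vertices t" for s u v
    using that
  proof (induction v rule: rev_induct)
    case (snoc x v)
    then have *: "(u @ v) @ [x] \<in> vertices t"
      by simp
    have "coord s (g (u @ v)) \<le> coord s (g ((u @ v) @ [x]))"
      using step[OF *] by (cases "x = s") (auto simp: precedes_def eq_opposite_iff[symmetric])
    then show ?case
      using snoc.IH[OF vertices_prefix[OF *]] by simp
  qed simp
  have "a s \<in> increasing_labellings (edges s t) 1" for s
  proof -
    \<comment> \<open>Strictness comes from the last edge of \<open>w\<close>, which is an
      \<open>s\<close>-edge.\<close>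
    have less: "coord s (g u) < coord s (g w)" if "u < w" "w \<in> edges s t" for u w
    proof -
      obtain w' where w: "w = w' @ [s]" "w \<in> vertices t"
        using \<open>w \<in> edges s t\<close> by (auto simp: edges_def)
      then have "prefix u w'"
        using \<open>u < w\<close> by (auto simp: less_list_def' strict_prefix_def)
      then obtain z where z: "w' = u @ z"
        by (auto simp: prefix_def)
      have "u @ z \<in> vertices t"
        using w z vertices_prefix by blast
      then have "coord s (g u) \<le> coord s (g w')"
        using mono z by blast
      also have "\<dots> < coord s (g w)"
        using step w by (auto simp: precedes_def)
      finally show ?thesis .
    qed
    have pos: "0 < coord s (g w)" if "w \<in> edges s t" for w
      using less[of "[]" w] that by (auto simp: g_Nil edges_def less_list_def' strict_prefix_def)
    \<comment> \<open>End points of two \<open>s\<close>-edges with equal labels would share a line,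
      so one would precede the other in the opposite direction.\<close>
    have "inj_on (a s) (edges s t)"
    proof (rule inj_onI, rule ccontr)
      fix u w assume *: "u \<in> edges s t" "w \<in> edges s t" "a s u = a s w" "u \<noteq> w"
      \<comment> \<open>The end point of an \<open>s\<close>-edge is already preceded by its parent
        in direction \<open>s\<close>; the exactly-one condition then excludes a predecessor in the
        other direction.\<close>
      have no_precedes: "\<not> precedes (opposite s) (g u) (g w)"
        if uw: "u \<in> edges s t" "w \<in> edges s t" for u w
      proof
        assume prec: "precedes (opposite s) (g u) (g w)"
        obtain w' where w: "w = w' @ [s]" "w \<in> vertices t"
          using uw(2) by (auto simp: edges_def)
        have "g w' \<in> A" "g u \<in> A" "g w \<in> A"
          using gA vertices_prefix[of w' "[s]"] w uw by (simp_all add: edges_def)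
        moreover have "g w \<noteq> (0, 0)"
          using pos[OF uw(2)] by auto
        moreover have "precedes s (g w') (g w)"
          using step w by simp
        ultimately have "s = opposite s"
          using A'(3)[of "g w"] prec by blast
        then show False
          by simp
      qed
      have eq: "coord s (g u) = coord s (g w)"
        using * by (simp add: a_def)
      have "g u \<noteq> g w"
        using * fg[of u] fg[of w] by (auto simp: edges_def)
      then obtain s' where s': "coord s' (g u) \<noteq> coord s' (g w)"
        using point_eqI by blast
      with eq have "s' \<noteq> s"
        by metis
      then have "s' = opposite s"
        by (simp only: eq_opposite_iff not_False_eq_True)
      with s' have "coord (opposite s) (g u) \<noteq> coord (opposite s) (g w)"
        by simp
      then have "precedes (opposite s) (g u) (g w) \<or> precedes (opposite s) (g w) (g u)"
        using eq by (auto simp: precedes_def)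
      then show False
        using no_precedes * by blast
    qed
    moreover have "a s ` edges s t = {1..<1 + card (edges s t)}"
    proof -
      \<comment> \<open>The \<open>s\<close>-coordinates of \<open>A\<close> form an initial segment
        and consist of 0 and the labels. Counting them fixes its length, and removing 0 leaves the
        labels.\<close>
      let ?N = "coord s ` A"
      have "?N = (\<lambda>v. a s (strip (opposite s) v)) ` vertices t"
        using g strip by (auto simp: bij_betw_def image_image intro!: image_cong)
      also have "\<dots> = insert (a s []) (a s ` edges s t)"
        unfolding image_insert[symmetric]
      proof (intro equalityI subsetI)
        fix x assume "x \<in> a s ` insert [] (edges s t)"
        then obtain v where v: "v \<in> insert [] (edges s t)" "x = a s v"
          by blast
        then have "v \<in> vertices t" "strip (opposite s) v = v"
          using Nil_in_vertices[OF nonempty] strip_edge by (auto simp: edges_def)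
        then show "x \<in> (\<lambda>v. a s (strip (opposite s) v)) ` vertices t"
          using v(2) by force
      next
        fix x assume "x \<in> (\<lambda>v. a s (strip (opposite s) v)) ` vertices t"
        then show "x \<in> a s ` insert [] (edges s t)"
          using strip_in_edges by blast
      qed
      also have "a s [] = 0"
        by (simp add: a_def Nil_notin_edges)
      finally have N: "?N = insert 0 (a s ` edges s t)" .
      have "0 \<notin> a s ` edges s t"
      proof
        assume "0 \<in> a s ` edges s t"
        then obtain v where "v \<in> edges s t" "a s v = 0"
          by force
        then show False
          using pos[of v] by (simp add: a_def)
      qed
      then have "card ?N = Suc (card (edges s t))"
        using \<open>inj_on (a s) (edges s t)\<close> by (simp add: N finite_edges card_image)
      moreover have "?N = {..<card ?N}"
      proof (rule initial_segment_eq)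
        show "x \<in> ?N" if xy: "y \<in> ?N" "x < y" for x y
        proof -
          obtain p where "p \<in> A" "x < coord s p"
            using xy by blast
          then obtain q where "q \<in> A" "coord s q = x"
            using A'(4) by blast
          then show ?thesis
            by blast
        qed
      qed (use A'(1) in simp)
      ultimately have "insert 0 (a s ` edges s t) = {..<Suc (card (edges s t))}"
        using N by simp
      then have "a s ` edges s t = {..<Suc (card (edges s t))} - {0}"
        using \<open>0 \<notin> a s ` edges s t\<close> by blast
      moreover have "{..<Suc n} - {0} = {1..<1 + n}" for n
        by auto
      ultimately show ?thesis
        by (simp only:)
    qed
    moreover have "strict_mono_on (edges s t) (a s)"
      by (rule strict_mono_onI) (simp add: less a_def)
    moreover have "a s v = 0" if "v \<notin> edges s t" for v
      using that by (simp add: a_def)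
    ultimately show ?thesis
      unfolding increasing_labellings_def bij_betw_def by blast
  qed
  then have "labelled_tree t a"
    using nonempty by unfold_locales
  moreover have "g v = position a v" if "v \<in> vertices t" for v
    using strip[OF that] by (intro point_eqI) simp
  then have "A = position a ` vertices t"
    using g by (auto simp: bij_betw_def)
  ultimately show thesis
    by (rule that)
qed

section \<open>Counting pairs of labellings\<close>

lemma UNIV_side: "(UNIV :: side set) = {Lft, Rgt}"
  by (metis (full_types) UNIV_eq_I insertCI side.exhaust)

text \<open>The labellings of the two sides are chosen independently, and the point set and the pair
  of labellings determine each other.\<close>

lemma NA_eq:
  assumes "t \<noteq> Leaf"
  shows "NA t = card (increasing_labellings (edges Lft t) 1) * card (increasing_labellings (edges Rgt t) 1)"
proof -
  \<comment> \<open>A pair of labellings is encoded as a function of the side, so the product rule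
    becomes the cardinality of a function space.\<close>
  let ?L = "PiE UNIV (\<lambda>s. increasing_labellings (edges s t) 1)"
  have L: "a \<in> ?L \<longleftrightarrow> labelled_tree t a" for a
    using assms by (auto simp: labelled_tree_def PiE_UNIV_domain)
  have "bij_betw (\<lambda>a. position a ` vertices t) ?L {A. non_ambiguous_tree A \<and> has_underlying_tree A t}"
    unfolding bij_betw_def
  proof
    show "inj_on (\<lambda>a. position a ` vertices t) ?L"
      by (rule inj_onI, rule position_image_inj) (simp_all only: L)
    show "(\<lambda>a. position a ` vertices t) ` ?L = {A. non_ambiguous_tree A \<and> has_underlying_tree A t}"
    proof (intro equalityI subsetI)
      fix A assume "A \<in> (\<lambda>a. position a ` vertices t) ` ?L"
      then show "A \<in> {A. non_ambiguous_tree A \<and> has_underlying_tree A t}"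
        using labelled_tree.non_ambiguous_tree_points labelled_tree.has_underlying_tree_points
        by (auto simp only: L)
    next
      fix A assume "A \<in> {A. non_ambiguous_tree A \<and> has_underlying_tree A t}"
      then obtain a where "labelled_tree t a" "A = position a ` vertices t"
        using labelling_exists by blast
      then show "A \<in> (\<lambda>a. position a ` vertices t) ` ?L"
        unfolding L[symmetric] by blast
    qed
  qed
  then have "NA t = card ?L"
    unfolding NA_def by (rule bij_betw_same_card[symmetric])
  also have "\<dots> = (\<Prod>s\<in>UNIV. card (increasing_labellings (edges s t) 1))"
    by (rule card_PiE) (simp add: UNIV_side)
  finally show ?thesis
    by (simp add: UNIV_side)
qed

theorem proposition8:
  fixes T :: "unit tree"
  assumes "T \<noteq> Leaf"
  shows "real (NA T) =
    fact (card (left_edges T)) * fact (card (right_edges T)) /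
    ((\<Prod>e\<in>left_edges T. real (n_left T e)) * (\<Prod>e\<in>right_edges T. real (n_right T e)))"
  unfolding NA_eq[OF assms] of_nat_mult card_increasing_labellings_edges
  by (simp add: n_left_def n_right_def left_edges_eq right_edges_eq)

end
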